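(* Let $(X,A)$ and $(X_i,A_i)_{i\in\mathbb{N}}$ be compact pairs such that $X=\bigcup_{i\in\mathbb{N}}X_i$ and $A=\bigcup_{i\in\mathbb{N}}A_i$. Assume that $(X,A)$ is almost Euclidean. If every cone pair $\mathsf{C}(X_i,A_i)$ has the surjection property, then $\mathsf{C}(X,A)$ has the surjection property.
   Context: A compact pair $(X,A)$ consists of a compact metrizable space $X$ and a compact subset $A\subseteq X$. A point of a space is Euclidean if it has an open neighborhood homeomorphic to $\mathbb{R}^n$ for some $n\geq1$. A space is almost Euclidean if its Euclidean points are dense. A pair $(X,A)$ is almost Euclidean if $X\setminus A$ is almost Euclidean. The cone $\mathsf{C}(X)$ is the quotient of $X\times[0,1]$ identifying all points $(x,0)$ (the tip); $X$ is embedded in it as $X\times\{1\}$, and $\mathsf{C}(\emptyset)=\emptyset$. The cone pair is $\mathsf{C}(X,A)=(\mathsf{C}(X),X\cup\mathsf{C}(A))$. A pair $(Z,B)$ has the surjection property if every continuous $f:Z\to Z$ with $f|_B=\mathrm{id}_B$ is surjective. *)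

theory Defs
  imports "HOL-Analysis.Analysis"
begin

definition compact_pair :: "'a topology \<Rightarrow> 'a set \<Rightarrow> bool" where
  "compact_pair X A \<longleftrightarrow> compact_space X \<and> metrizable_space X \<and> compactin X A"

definition Euclidean_point :: "'a topology \<Rightarrow> 'a \<Rightarrow> bool" where
  "Euclidean_point X x \<longleftrightarrow>
     (\<exists>U n. openin X U \<and> x \<in> U \<and> n \<ge> 1 \<and> subtopology X U homeomorphic_space Euclidean_space n)"

definition almost_Euclidean :: "'a topology \<Rightarrow> bool" where
  "almost_Euclidean X \<longleftrightarrow> X closure_of {x \<in> topspace X. Euclidean_point X x} = topspace X"

definition almost_Euclidean_pair :: "'a topology \<Rightarrow> 'a set \<Rightarrow> bool" where
  "almost_Euclidean_pair X A \<longleftrightarrow> almost_Euclidean (subtopology X (topspace X - A))"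

definition quotient_topology :: "'a topology \<Rightarrow> ('a \<Rightarrow> 'b) \<Rightarrow> 'b topology" where
  "quotient_topology X q =
     topology (\<lambda>U. U \<subseteq> q ` topspace X \<and> openin X {x \<in> topspace X. q x \<in> U})"

lemma openin_quotient_topology:
  "openin (quotient_topology X q) U \<longleftrightarrow>
     U \<subseteq> q ` topspace X \<and> openin X {x \<in> topspace X. q x \<in> U}"
proof -
  have "istopology (\<lambda>U. U \<subseteq> q ` topspace X \<and> openin X {x \<in> topspace X. q x \<in> U})"
    unfolding istopology_def
  proof (intro conjI allI impI)
    fix S T
    assume S: "S \<subseteq> q ` topspace X \<and> openin X {x \<in> topspace X. q x \<in> S}"
      and T: "T \<subseteq> q ` topspace X \<and> openin X {x \<in> topspace X. q x \<in> T}"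
    then show "S \<inter> T \<subseteq> q ` topspace X" by blast
    have "{x \<in> topspace X. q x \<in> S \<inter> T} =
        {x \<in> topspace X. q x \<in> S} \<inter> {x \<in> topspace X. q x \<in> T}" by blast
    then show "openin X {x \<in> topspace X. q x \<in> S \<inter> T}" using S T by auto
  next
    fix K
    assume K: "\<forall>U\<in>K. U \<subseteq> q ` topspace X \<and> openin X {x \<in> topspace X. q x \<in> U}"
    then show "\<Union>K \<subseteq> q ` topspace X" by blast
    have "{x \<in> topspace X. q x \<in> \<Union>K} = (\<Union>U\<in>K. {x \<in> topspace X. q x \<in> U})" by blast
    then show "openin X {x \<in> topspace X. q x \<in> \<Union>K}" using K by auto
  qed
  then show ?thesis by (simp add: quotient_topology_def)
qed

lemma topspace_quotient_topology [simp]: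
  "topspace (quotient_topology X q) = q ` topspace X"
proof
  show "topspace (quotient_topology X q) \<subseteq> q ` topspace X"
    using openin_quotient_topology[of X q] by (simp add: topspace_def) blast
  have "{x \<in> topspace X. q x \<in> q ` topspace X} = topspace X" by blast
  then have "openin (quotient_topology X q) (q ` topspace X)"
    by (simp add: openin_quotient_topology)
  then show "q ` topspace X \<subseteq> topspace (quotient_topology X q)" by (rule openin_subset)
qed

lemma quotient_map_quotient_topology: "quotient_map X (quotient_topology X q) q"
  by (auto simp: quotient_map_def openin_quotient_topology)

text \<open>
  \<open>cone_class p\<close> is the equivalence class of \<open>p\<close> under the relation that identifies all
  points \<open>(x, 0)\<close>. The relation is taken on the whole type, not only on \<open>X \<times> [0,1]\<close>: the
  quotient is the same, but the tip then does not depend on \<open>X\<close>, so the cone over a subset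
  of \<open>X\<close> is literally a subset of the cone over \<open>X\<close>.
\<close>

definition cone_class :: "'a \<times> real \<Rightarrow> ('a \<times> real) set" where
  "cone_class p = {r. r = p \<or> snd r = 0 \<and> snd p = 0}"

definition cone_space :: "'a topology \<Rightarrow> ('a \<times> real) set topology" where
  "cone_space X = quotient_topology (prod_topology X (top_of_set {0..1})) cone_class"

text \<open>The subset \<open>X \<union> C(A)\<close> of \<open>C(X)\<close>, where \<open>X\<close> sits in \<open>C(X)\<close> as \<open>X \<times> {1}\<close>.\<close>

definition cone_base :: "'a topology \<Rightarrow> 'a set \<Rightarrow> ('a \<times> real) set set" where
  "cone_base X A = cone_class ` (topspace X \<times> {1}) \<union> topspace (cone_space (subtopology X A))"

definition surjection_property :: "'b topology \<Rightarrow> 'b set \<Rightarrow> bool" where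
  "surjection_property Z B \<longleftrightarrow>
     (\<forall>f. continuous_map Z Z f \<and> (\<forall>b\<in>B. f b = b) \<longrightarrow> f ` topspace Z = topspace Z)"

lemma cone_class_eq_iff:
  "cone_class p = cone_class r \<longleftrightarrow> p = r \<or> snd p = 0 \<and> snd r = 0"
  unfolding cone_class_def by blast

lemma quotient_map_cone_space:
  "quotient_map (prod_topology X (top_of_set {0..1})) (cone_space X) cone_class"
  unfolding cone_space_def by (rule quotient_map_quotient_topology)

lemma topspace_cone_space: "topspace (cone_space X) = cone_class ` (topspace X \<times> {0..1})"
  by (simp add: cone_space_def)

lemma topspace_cone_space_eq_empty_iff: "topspace (cone_space X) = {} \<longleftrightarrow> topspace X = {}"
  by (simp add: topspace_cone_space)

lemma cone_base_subset: "cone_base X A \<subseteq> topspace (cone_space X)"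
  by (auto simp: cone_base_def topspace_cone_space)

end

theory Submission
  imports Defs
begin

text \<open>
  Suppose that a continuous self-map \<open>f\<close> of the cone over \<open>X\<close> fixes \<open>X\<close> and the cone over \<open>A\<close>
  and is not surjective. Its image is closed, so it misses a whole slab \<open>W \<times> {m}\<close>
  with \<open>W\<close> open and nonempty and \<open>m > 0\<close> (\<open>missed_slab\<close>). By Baire's theorem some \<open>X\<^sub>i\<close> contains
  a nonempty open subset of \<open>W\<close> (\<open>Baire_closed_cover\<close>), and \<open>W\<close> may be shrunk to it.

  It remains to turn \<open>f\<close> into a non-surjective self-map of the cone over \<open>X\<^sub>i\<close> that fixes \<open>X\<^sub>i\<close>
  and the cone over \<open>A\<^sub>i\<close> (\<open>not_surjection_property_if_slab_missed\<close>). The obstacle is that \<open>f\<close> may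
  move the cone over \<open>X\<^sub>i\<close> outside itself. The missed slab removes it: once the slab is absent,
  the part of the cone over \<open>W\<close> and higher than \<open>m\<close> touches the rest only over the boundary of
  \<open>W\<close>. So the rest can be collapsed continuously to the tip, if the part over \<open>W\<close> is
  lowered to the tip towards that boundary (\<open>collapse_off_slab\<close>); and the part over \<open>W\<close> lies
  in the cone over \<open>X\<^sub>i\<close>. In other words, \<open>f\<close> is used only to contract the quotient map of \<open>X\<close>
  by the complement of \<open>W\<close> to a point, and this null-homotopy, restricted to \<open>X\<^sub>i\<close>, is what
  a non-surjective map on the cone over \<open>X\<^sub>i\<close> is built from.
\<close>

abbreviation unit_interval :: "real topology" where
  "unit_interval \<equiv> top_of_set {0..1}"

section \<open>Topology of the cone\<close>

lemma cone_class_in_cone_space: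
  "x \<in> topspace X \<Longrightarrow> t \<in> {0..1} \<Longrightarrow> cone_class (x, t) \<in> topspace (cone_space X)"
  by (auto simp: topspace_cone_space)

lemma cone_class_tip: "cone_class (x, 0) = cone_class (y, 0)"
  by (simp add: cone_class_eq_iff)

lemma continuous_map_cone_class:
  assumes "continuous_map Z X u" "continuous_map Z unit_interval v"
  shows "continuous_map Z (cone_space X) (\<lambda>z. cone_class (u z, v z))"
proof -
  have "continuous_map Z (prod_topology X unit_interval) (\<lambda>z. (u z, v z))"
    using assms by (simp add: continuous_map_pairwise o_def)
  then have "continuous_map Z (cone_space X) (cone_class \<circ> (\<lambda>z. (u z, v z)))"
    using quotient_imp_continuous_map[OF quotient_map_cone_space]
    by (rule continuous_map_compose)
  then show ?thesis by (simp add: o_def)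
qed

text \<open>
  The saturation of a closed set is the set itself or its union with the bottom \<open>X \<times> {0}\<close>.
\<close>

lemma closed_map_cone_class:
  "closed_map (prod_topology X unit_interval) (cone_space X) cone_class"
  unfolding closed_map_def
proof (intro allI impI)
  let ?P = "prod_topology X unit_interval"
  fix D assume D: "closedin ?P D"
  have DP: "D \<subseteq> topspace ?P" using D by (rule closedin_subset)
  have "closedin unit_interval {0}" by (simp add: closedin_closed_subset)
  then have bot: "closedin ?P (topspace X \<times> {0})" by (simp add: closedin_prod_Times_iff)
  have "{p \<in> topspace ?P. cone_class p \<in> cone_class ` D}
      = (if \<exists>p\<in>D. snd p = 0 then D \<union> topspace X \<times> {0} else D)"
    using DP by (auto simp: cone_class_eq_iff image_iff)
  then have "closedin ?P {p \<in> topspace ?P. cone_class p \<in> cone_class ` D}"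
    using D bot by (simp add: closedin_Un)
  moreover have "cone_class ` D \<subseteq> topspace (cone_space X)"
    using DP by (auto simp: topspace_cone_space)
  ultimately show "closedin (cone_space X) (cone_class ` D)"
    using quotient_map_cone_space[of X] unfolding quotient_map_closedin by blast
qed

lemma compact_space_cone_space:
  assumes "compact_space X"
  shows "compact_space (cone_space X)"
proof -
  have "compact_space (prod_topology X unit_interval)"
    using assms by (simp add: compact_space_prod_topology compact_space_subtopology)
  then show ?thesis
    using image_compactin[OF _ quotient_imp_continuous_map[OF quotient_map_cone_space]]
      quotient_imp_surjective_map[OF quotient_map_cone_space[of X]]
    unfolding compact_space_def by metis
qed

lemma Hausdorff_space_cone_space:
  assumes "compact_space X" "Hausdorff_space X"
  shows "Hausdorff_space (cone_space X)"
proof -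
  let ?P = "prod_topology X unit_interval"
  have H: "Hausdorff_space ?P"
    using assms by (simp add: Hausdorff_space_prod_topology Hausdorff_space_subtopology)
  have "compact_space ?P"
    using assms by (simp add: compact_space_prod_topology compact_space_subtopology)
  with H have "normal_space ?P"
    using compact_Hausdorff_or_regular_imp_normal_space by blast
  then show ?thesis
    using normal_Hausdorff_space_closed_continuous_map_image[OF _ H closed_map_cone_class]
      quotient_imp_continuous_map[OF quotient_map_cone_space]
      quotient_imp_surjective_map[OF quotient_map_cone_space] by blast
qed

lemma closedin_image_cone_space:
  assumes "compact_space X" "Hausdorff_space X" "continuous_map (cone_space X) (cone_space X) f"
  shows "closedin (cone_space X) (f ` topspace (cone_space X))"
proof -
  have "compactin (cone_space X) (topspace (cone_space X))"
    using compact_space_cone_space[OF assms(1)] by (simp add: compact_space_def)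
  then show ?thesis
    by (rule compactin_imp_closedin[OF Hausdorff_space_cone_space[OF assms(1,2)]
          image_compactin[OF _ assms(3)]])
qed

section \<open>Missed slabs\<close>

text \<open>
  The complement of the image is open, so it contains a box around a missed point. If that point
  is the tip, the box still contains points of small positive height.
\<close>

lemma missed_slab:
  assumes X: "compact_space X" "Hausdorff_space X"
    and f: "continuous_map (cone_space X) (cone_space X) f"
    and miss: "f ` topspace (cone_space X) \<noteq> topspace (cone_space X)"
  obtains W m where "openin X W" "W \<noteq> {}" "0 < m" "m \<le> 1"
    "\<And>x. x \<in> W \<Longrightarrow> cone_class (x, m) \<notin> f ` topspace (cone_space X)"
proof -
  let ?P = "prod_topology X unit_interval"
  let ?F = "f ` topspace (cone_space X)"
  have F: "closedin (cone_space X) ?F"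
    using X f by (rule closedin_image_cone_space)
  define N where "N = {p \<in> topspace ?P. cone_class p \<in> topspace (cone_space X) - ?F}"
  have N: "openin ?P N"
    unfolding N_def
    by (rule openin_continuous_map_preimage[OF quotient_imp_continuous_map[OF quotient_map_cone_space]])
       (use F in blast)
  have "?F \<subseteq> topspace (cone_space X)"
    using F by (rule closedin_subset)
  with miss obtain p where "p \<in> N"
    unfolding N_def topspace_cone_space by auto
  then obtain W T where WT: "openin X W" "openin unit_interval T" "fst p \<in> W" "snd p \<in> T"
    "W \<times> T \<subseteq> N"
    using N unfolding openin_prod_topology_alt by (metis prod.collapse)
  obtain m where m: "m \<in> T" "0 < m" "m \<le> 1"
  proof (cases "snd p = 0")
    case False
    have "snd p \<in> {0..1}" using openin_subset[OF WT(2)] WT(4) by auto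
    with False show ?thesis using that[of "snd p"] WT(4) by auto
  next
    case True
    obtain e where e: "e > 0" "ball 0 e \<inter> {0..1} \<subseteq> T"
      using WT(2,4) True by (metis openin_contains_ball)
    have "min 1 (e / 2) \<in> ball 0 e \<inter> {0..1}" using e by (auto simp: dist_norm)
    then have "min 1 (e / 2) \<in> T" using e(2) by (rule rev_subsetD)
    then show ?thesis using that[of "min 1 (e / 2)"] e(1) by simp
  qed
  show ?thesis
  proof
    show "openin X W" "W \<noteq> {}" "0 < m" "m \<le> 1" using WT m by auto
    show "cone_class (x, m) \<notin> ?F" if "x \<in> W" for x
      using that m WT(5) unfolding N_def by auto
  qed
qed

text \<open>
  An open subspace of a compact Hausdorff space is locally compact, hence a Baire space.
\<close>

lemma Baire_closed_cover:
  assumes X: "compact_space X" "Hausdorff_space X"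
    and cl: "\<And>i::nat. closedin X (Xs i)"
    and W: "openin X W" "W \<noteq> {}" "W \<subseteq> (\<Union>i. Xs i)"
  obtains i V where "openin X V" "V \<noteq> {}" "V \<subseteq> W" "V \<subseteq> Xs i"
proof -
  let ?S = "subtopology X W"
  have reg: "regular_space X"
    using X by (simp add: compact_Hausdorff_imp_regular_space)
  have "locally_compact_space ?S" "regular_space ?S"
    using X reg W(1) 
    by (auto intro: locally_compact_space_open_subset compact_imp_locally_compact_space regular_space_subtopology)
  moreover have "?S interior_of (\<Union>(range (\<lambda>i. W \<inter> Xs i))) \<noteq> {}"
  proof -
    have eq: "\<Union>(range (\<lambda>i. W \<inter> Xs i)) = topspace ?S"
      using W openin_subset by fastforce
    show ?thesis
      unfolding eq interior_of_topspace using W(2) openin_subset[OF W(1)] by auto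
  qed
  moreover have "closedin ?S (W \<inter> Xs i)" for i
    using cl by (simp add: closedin_subtopology_Int_closed)
  ultimately obtain i where "?S interior_of (W \<inter> Xs i) \<noteq> {}"
    using Baire_category_alt[of ?S "range (\<lambda>i. W \<inter> Xs i)"] by auto
  moreover have "openin X (?S interior_of (W \<inter> Xs i))"
    using openin_trans_full[OF openin_interior_of W(1)] .
  moreover have "?S interior_of (W \<inter> Xs i) \<subseteq> W \<inter> Xs i"
    by (rule interior_of_subset)
  ultimately show ?thesis using that by blast
qed

section \<open>Collapsing the complement of a slab\<close>

text \<open>
  The section \<open>x \<mapsto> (x, 1)\<close> of the cone, pushed down to the tip off \<open>W\<close>. Off \<open>W\<close> the base
  coordinate is lost at the tip, so that over all of \<open>X\<close> the map takes values in the cone over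
  any closed \<open>Y\<close> containing \<open>W\<close>; it glues because \<open>Y\<close> and the complement of \<open>W\<close> are two closed
  sets covering \<open>X\<close>.
\<close>

lemma continuous_map_lowered_section:
  assumes Y: "closedin X Y" and W: "openin X W" "W \<subseteq> Y" and y: "y \<in> Y"
    and \<beta>: "continuous_map X unit_interval \<beta>"
    and \<beta>1: "\<And>x. x \<in> topspace X \<Longrightarrow> x \<notin> W \<Longrightarrow> \<beta> x = 1"
  shows "continuous_map X (cone_space (subtopology X Y)) (\<lambda>x. cone_class (x, 1 - \<beta> x))"
proof -
  let ?SY = "subtopology X Y"
  let ?k = "\<lambda>x. cone_class (x, 1 - \<beta> x)"
  let ?tip = "\<lambda>x::'a. cone_class (y, 0::real)"
  let ?T = "\<lambda>b. if b then Y else topspace X - W"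
  have tip_in: "?tip x \<in> topspace (cone_space ?SY)" for x
    using y closedin_subset[OF Y] by (intro cone_class_in_cone_space) auto
  have tip: "?k x = ?tip x" if "x \<in> topspace X" "x \<notin> W" for x
    using \<beta>1[OF that] by (simp add: cone_class_eq_iff)
  have "continuous_map X euclideanreal \<beta>" and \<beta>01: "\<And>x. x \<in> topspace X \<Longrightarrow> \<beta> x \<in> {0..1}"
    using \<beta> by (auto simp: continuous_map_in_subtopology)
  then have "continuous_map ?SY unit_interval (\<lambda>x. 1 - \<beta> x)"
    by (auto simp: continuous_map_in_subtopology
        intro!: continuous_intros continuous_map_from_subtopology)
  then have k: "continuous_map ?SY (cone_space ?SY) ?k"
    by (intro continuous_map_cone_class continuous_map_id[unfolded id_def])
  show ?thesis
  proof (rule pasting_lemma_closed[of "{True, False}" X ?T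
        "cone_space ?SY" "\<lambda>b. if b then ?k else ?tip"])
    fix b :: bool
    show "closedin X (?T b)" using Y W(1) by auto
    show "continuous_map (subtopology X (?T b)) (cone_space ?SY) (if b then ?k else ?tip)"
      using k tip_in by simp
  next
    fix b c x
    assume "x \<in> topspace X \<inter> ?T b \<inter> ?T c"
    then show "(if b then ?k else ?tip) x = (if c then ?k else ?tip) x"
      using tip[of x] by (cases b; cases c) simp_all
  next
    fix x assume x: "x \<in> topspace X"
    show "\<exists>b. b \<in> {True, False} \<and> x \<in> ?T b \<and> ?k x = (if b then ?k else ?tip) x"
    proof (cases "x \<in> Y")
      case True
      then show ?thesis by (intro exI[of _ True]) simp
    next
      case False
      then have "x \<notin> W" using W(2) by blast
      then show ?thesis using x tip[of x] by (intro exI[of _ False]) simp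
    qed
  qed simp
qed

text \<open>
  A map on the base extends over the part of the cone at heights \<open>\<ge> m\<close> by forgetting the height,
  and the rest of the cone can be sent to one point \<open>c\<close>. The two pieces meet at height \<open>m\<close> only,
  and they fit together on every closed set \<open>F\<close> of the cone that avoids the slab
  of points \<open>(x, m)\<close> with \<open>k x \<noteq> c\<close>.
\<close>

lemma collapse_off_slab:
  assumes F: "closedin (cone_space X) F" and k: "continuous_map X Z k"
    and c: "c \<in> topspace Z" and m: "0 < m"
    and off_slab: "\<And>x. x \<in> topspace X \<Longrightarrow> cone_class (x, m) \<in> F \<Longrightarrow> k x = c"
  obtains Q where "continuous_map (subtopology (cone_space X) F) Z Q"
    "\<And>x t. x \<in> topspace X \<Longrightarrow> t \<in> {0..1} \<Longrightarrow> cone_class (x, t) \<in> F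
      \<Longrightarrow> Q (cone_class (x, t)) = (if m \<le> t then k x else c)"
proof -
  let ?P = "prod_topology X unit_interval"
  define D where "D = {p \<in> topspace ?P. cone_class p \<in> F}"
  define Q' where "Q' p = (if m \<le> snd p then k (fst p) else c)" for p
  have "continuous_map (subtopology ?P D) Z Q'"
    unfolding Q'_def
  proof (rule continuous_map_cases_le)
    have fst: "continuous_map ?P X fst" and snd: "continuous_map ?P euclideanreal snd"
      using continuous_map_fst continuous_map_snd continuous_map_in_subtopology by blast+
    show "continuous_map (subtopology ?P D) euclideanreal snd"
      using snd by (rule continuous_map_from_subtopology)
    show "continuous_map (subtopology (subtopology ?P D)
        {x \<in> topspace (subtopology ?P D). m \<le> snd x}) Z (\<lambda>p. k (fst p))"
      using continuous_map_compose[OF fst k, unfolded o_def]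
      by (intro continuous_map_from_subtopology)
    show "k (fst p) = c" if "p \<in> topspace (subtopology ?P D)" "m = snd p" for p
      using that by (intro off_slab) (auto simp: D_def)
  qed (use c in auto)
  moreover have "quotient_map (subtopology ?P D) (subtopology (cone_space X) F) cone_class"
    by (rule quotient_map_restriction[OF quotient_map_cone_space]) (use F D_def in auto)
  \<comment> \<open>Below the height \<open>m > 0\<close> the map is constant, so it is well defined at the tip.\<close>
  moreover have "Q' p = Q' q" if "cone_class p = cone_class q" for p q
    using that m by (auto simp: cone_class_eq_iff Q'_def)
  ultimately obtain Q where Q: "continuous_map (subtopology (cone_space X) F) Z Q"
      and Qeq: "\<And>p. p \<in> topspace (subtopology ?P D) \<Longrightarrow> Q (cone_class p) = Q' p"
    using quotient_map_lift_exists[of "subtopology ?P D" "subtopology (cone_space X) F" cone_class Z Q']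
    by metis
  show ?thesis
    by (rule that[OF Q]) (use Qeq in \<open>auto simp: Q'_def D_def\<close>)
qed

section \<open>Passing to a closed subspace\<close>

text \<open>
  The non-surjective map \<open>g\<close> on the cone over \<open>Y\<close> comes from a homotopy of the section
  \<open>x \<mapsto> (x, 1)\<close> in two stages, as the height runs from \<open>1\<close> down to \<open>0\<close>. Fix a point \<open>x0\<close> of \<open>W\<close>
  and a bump \<open>\<beta>\<close> that is \<open>0\<close> at \<open>x0\<close> and \<open>1\<close> off a small neighbourhood \<open>W'\<close> of \<open>x0\<close>.
  The first stage lowers \<open>(x, 1)\<close> to \<open>k x = (x, 1 - \<beta> x)\<close>; the second one is \<open>Q \<circ> f\<close>, where \<open>Q\<close>
  maps the image of \<open>f\<close> to the tip and the image of \<open>k\<close>. Since \<open>f\<close> fixes the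
  points \<open>(x, 1)\<close>, the second stage starts at \<open>k\<close>, and it ends in a constant map because
  \<open>f\<close> is defined at the tip. Over \<open>x0\<close>, where \<open>\<beta>\<close> vanishes, the first stage and the image of \<open>k\<close>
  have only the point at height \<open>1\<close>, so \<open>(x0, 1/2)\<close> is never reached.

  On \<open>B\<close> the first stage alone is \<open>(x, t) \<mapsto> (x, t)\<close>, if it takes the whole interval of heights;
  over base points where the second stage is not constant, it has to leave room for that stage
  and is over by the height \<open>1/2\<close>. The function \<open>d\<close> sets this pace: the first stage occupies the heights from \<open>d x / 2\<close> to \<open>1\<close>. That \<open>d\<close>
  varies does no harm, because near \<open>B\<close> the second stage rests at the tip: \<open>f\<close> is the
  identity on the cone over \<open>B\<close>, which is away from \<open>W'\<close>.
\<close>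

lemma not_surjection_property_if_slab_missed:
  assumes X: "compact_space X" "Hausdorff_space X"
    and Y: "closedin X Y" and B: "closedin X B" "B \<subseteq> Y"
    and f: "continuous_map (cone_space X) (cone_space X) f"
    and f_top: "\<And>x. x \<in> topspace X \<Longrightarrow> f (cone_class (x, 1)) = cone_class (x, 1)"
    and f_B: "\<And>x t. x \<in> B \<Longrightarrow> t \<in> {0..1} \<Longrightarrow> f (cone_class (x, t)) = cone_class (x, t)"
    and W: "openin X W" "W \<noteq> {}" "W \<subseteq> Y"
    and m: "0 < m" "m \<le> 1"
    and missed: "\<And>x. x \<in> W \<Longrightarrow> cone_class (x, m) \<notin> f ` topspace (cone_space X)"
  shows "\<not> surjection_property (cone_space (subtopology X Y)) (cone_base (subtopology X Y) B)"
proof -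
  let ?P = "prod_topology X unit_interval"
  let ?SY = "subtopology X Y"
  let ?PY = "prod_topology ?SY unit_interval"
  let ?CX = "cone_space X" and ?CY = "cone_space ?SY"
  have YX: "Y \<subseteq> topspace X" using Y by (rule closedin_subset)
  \<comment> \<open>The points of \<open>B \<times> {m}\<close> are fixed, hence not missed.\<close>
  have WB: "W \<inter> B = {}"
  proof -
    have "cone_class (x, m) \<in> f ` topspace ?CX" if "x \<in> B" for x
    proof -
      have "cone_class (x, m) \<in> topspace ?CX"
        using that m B(2) YX by (intro cone_class_in_cone_space) auto
      then have "f (cone_class (x, m)) \<in> f ` topspace ?CX" by (rule imageI)
      then show ?thesis using f_B[OF that, of m] m by simp
    qed
    then show ?thesis using missed by blast
  qed
  have normal: "normal_space X"
    using X compact_Hausdorff_or_regular_imp_normal_space by blast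
  have reg: "regular_space X"
    using X by (simp add: compact_Hausdorff_imp_regular_space)
  obtain x0 where x0: "x0 \<in> W" using W(2) by blast
  \<comment> \<open>The closed set between \<open>W'\<close> and \<open>W\<close> keeps \<open>W'\<close> away from \<open>B\<close>, which may
    contain boundary points of \<open>W\<close>.\<close>
  obtain W' C where W': "openin X W'" "closedin X C" "x0 \<in> W'" "W' \<subseteq> C" "C \<subseteq> W"
    using reg x0 W(1) unfolding neighbourhood_base_of_closedin[symmetric] neighbourhood_base_of
    by metis
  have x0X: "x0 \<in> topspace X" "x0 \<in> Y" using x0 W openin_subset by auto
  obtain \<beta> where \<beta>: "continuous_map X unit_interval \<beta>" "\<beta> ` {x0} \<subseteq> {0}"
      "\<beta> ` (topspace X - W') \<subseteq> {1::real}"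
  proof (rule Urysohn_lemma[OF normal, of "{x0}" "topspace X - W'" 0 1])
    show "closedin X {x0}"
      using X x0X by (simp add: closedin_Hausdorff_singleton)
    show "closedin X (topspace X - W')" using W'(1) by blast
    show "disjnt {x0} (topspace X - W')" using W'(3) by (simp add: disjnt_def)
  qed (use that in auto)
  have \<beta>01: "0 \<le> \<beta> x" "\<beta> x \<le> 1" if "x \<in> topspace X" for x
    using continuous_map_funspace[OF \<beta>(1)] that by auto
  have \<beta>0: "\<beta> x0 = 0" using \<beta>(2) by auto
  have \<beta>1: "\<beta> x = 1" if "x \<in> topspace X" "x \<notin> W'" for x using \<beta>(3) that by auto
  define tip where "tip = cone_class (x0, 0::real)"
  have tip: "cone_class (x, 0) = tip" for x
    unfolding tip_def by (rule cone_class_tip)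
  have tip_in: "tip \<in> topspace ?CY"
    unfolding tip_def using x0X by (intro cone_class_in_cone_space) auto
  define k where "k x = cone_class (x, 1 - \<beta> x)" for x
  have k_tip: "k x = tip" if "x \<in> topspace X" "x \<notin> W'" for x
    using \<beta>1[OF that] tip by (simp add: k_def)
  have k: "continuous_map X ?CY k"
    unfolding k_def
    by (rule continuous_map_lowered_section[OF Y W'(1) _ x0X(2) \<beta>(1) \<beta>1])
       (use W' W(3) in blast)
  have \<beta>r: "continuous_map X euclideanreal \<beta>"
    using \<beta>(1) continuous_map_in_subtopology by blast
  define F where "F = f ` topspace ?CX"
  have F: "closedin ?CX F"
    unfolding F_def using X f by (rule closedin_image_cone_space)
  have fF: "f (cone_class p) \<in> F" if "p \<in> topspace ?P" for p
    using that by (auto simp: F_def topspace_cone_space)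
  have "k x = tip" if "x \<in> topspace X" "cone_class (x, m) \<in> F" for x
  proof -
    have "x \<notin> W" using that(2) missed unfolding F_def by blast
    then show ?thesis using that(1) W'(4,5) by (intro k_tip) auto
  qed
  then obtain Q where Q: "continuous_map (subtopology ?CX F) ?CY Q"
      and Qeq: "\<And>x t. x \<in> topspace X \<Longrightarrow> t \<in> {0..1} \<Longrightarrow> cone_class (x, t) \<in> F
        \<Longrightarrow> Q (cone_class (x, t)) = (if m \<le> t then k x else tip)"
    using collapse_off_slab[OF F k tip_in m(1)] by metis
  have Qf_top: "Q (f (cone_class (x, 1))) = k x" if "x \<in> topspace X" for x
    using Qeq[of x 1] fF[of "(x, 1)"] f_top[OF that] that m by auto
  have PYP: "continuous_map ?PY ?P id"
    by (simp add: continuous_map_pairwise o_def continuous_map_snd)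
       (use continuous_map_fst continuous_map_in_subtopology in blast)
  have fst: "continuous_map ?PY ?SY fst" "continuous_map ?PY X fst"
    and snd: "continuous_map ?PY euclideanreal snd"
    using continuous_map_fst continuous_map_snd continuous_map_in_subtopology by blast+
  have fc: "continuous_map ?PY ?CX (\<lambda>p. f (cone_class p))"
    using continuous_map_compose[OF continuous_map_compose[OF PYP
        quotient_imp_continuous_map[OF quotient_map_cone_space]] f] by (simp add: o_def)
  \<comment> \<open>The values of \<open>f\<close> that \<open>Q\<close> does not send to the tip lie over \<open>C\<close> at heights \<open>\<ge> m\<close>.
    The base points \<open>x\<close> for which some \<open>f (x, t)\<close> is of this kind form a set that is closed, by
    compactness of the interval, and disjoint from \<open>B\<close>.\<close>
  define K where "K = {p \<in> topspace ?PY. f (cone_class p) \<in> cone_class ` (C \<times> {m..1})}"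
  have "closedin ?CX (cone_class ` (C \<times> {m..1}))"
  proof -
    have "closedin unit_interval {m..1}" using m by (intro closed_subset) auto
    then have "closedin ?P (C \<times> {m..1})" using W'(2) by (simp add: closedin_prod_Times_iff)
    then show ?thesis using closed_map_cone_class[of X] unfolding closed_map_def by blast
  qed
  then have "closedin ?PY K"
    unfolding K_def using closedin_continuous_map_preimage[OF fc] by blast
  then have "closedin ?SY (fst ` K)"
    using closed_map_fst[of unit_interval ?SY]
    unfolding closed_map_def by (simp add: compact_space_subtopology)
  then have K: "closedin X (fst ` K)" using Y closedin_trans_full by blast
  have "B \<inter> fst ` K = {}"
  proof -
    have False if x: "x \<in> B" "(x, t) \<in> K" for x t
    proof -
      have "t \<in> {0..1}" using x by (auto simp: K_def)
      then have "cone_class (x, t) \<in> cone_class ` (C \<times> {m..1})"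
        using x f_B by (auto simp: K_def)
      then have "x \<in> C" using m by (auto simp: cone_class_eq_iff)
      then show False using W' WB x by blast
    qed
    then show ?thesis by force
  qed
  then obtain d where d: "continuous_map X unit_interval d" "d ` B \<subseteq> {0}" "d ` (fst ` K) \<subseteq> {1::real}"
    using Urysohn_lemma[OF normal B(1) K, of 0 1] by (auto simp: disjnt_def)
  have d01: "0 \<le> d x" "d x \<le> 1" if "x \<in> topspace X" for x
    using continuous_map_funspace[OF d(1)] that by auto
  have dr: "continuous_map X euclideanreal d"
    using d(1) continuous_map_in_subtopology by blast
  have Qf_tip: "Q (f (cone_class (x, t))) = tip"
    if x: "x \<in> Y" "d x \<noteq> 1" and t: "t \<in> {0..1}" for x t
  proof -
    have xt: "(x, t) \<in> topspace ?PY" "(x, t) \<in> topspace ?P" using x t YX by auto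
    have "(x, t) \<notin> K" using d(3) x by force
    then have nC: "f (cone_class (x, t)) \<notin> cone_class ` (C \<times> {m..1})"
      using xt by (auto simp: K_def)
    have inF: "f (cone_class (x, t)) \<in> F" using fF xt by blast
    then have "f (cone_class (x, t)) \<in> topspace ?CX" using F closedin_subset by blast
    then obtain y s where ys: "y \<in> topspace X" "s \<in> {0..1}" "f (cone_class (x, t)) = cone_class (y, s)"
      by (auto simp: topspace_cone_space)
    then have "Q (f (cone_class (x, t))) = (if m \<le> s then k y else tip)"
      using Qeq[of y s] inF by simp
    moreover have "y \<notin> W'" if "m \<le> s"
      using that nC ys W' by auto
    ultimately show ?thesis using k_tip ys by auto
  qed
  have k_tip_d: "k x = tip" if "x \<in> Y" "d x \<noteq> 1" for x
    using Qf_tip[OF that, of 1] Qf_top[of x] that YX by auto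
  \<comment> \<open>The cap at \<open>1\<close> and the factor \<open>1 + d\<close> stand in for the linear parameter
    \<open>(1 - t) / (1 - d / 2)\<close>: all that matters is \<open>s = 1 - t\<close> where \<open>d = 0\<close>, \<open>s = 0\<close> at height
    \<open>1\<close>, and \<open>s = 1\<close> at height \<open>d / 2\<close>.\<close>
  define s where "s p = min 1 ((1 - snd p) * (1 + d (fst p)))" for p :: "'a \<times> real"
  \<comment> \<open>Doubling the height is the right speed of the second stage where \<open>d = 1\<close>; where
    \<open>d < 1\<close> the second stage is constant, so that its speed does not matter there.\<close>
  define h where "h p = (if d (fst p) / 2 \<le> snd p
      then cone_class (fst p, 1 - s p * \<beta> (fst p))
      else Q (f (cone_class (fst p, min 1 (2 * snd p)))))" for p
  have \<beta>f: "continuous_map ?PY euclideanreal (\<lambda>p. \<beta> (fst p))"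
    and df: "continuous_map ?PY euclideanreal (\<lambda>p. d (fst p))"
    using continuous_map_compose[OF fst(2) \<beta>r] continuous_map_compose[OF fst(2) dr]
    by (simp_all add: o_def)
  have s01: "0 \<le> s p" "s p \<le> 1" if "p \<in> topspace ?PY" for p
    using that d01[of "fst p"] by (auto simp: s_def)
  have s1: "s p = 1" if "p \<in> topspace ?PY" "snd p = d (fst p) / 2" for p
  proof -
    let ?d = "d (fst p)"
    have "0 \<le> ?d * (1 - ?d)" using d01[of "fst p"] that by auto
    then have "1 \<le> (1 - ?d / 2) * (1 + ?d)" by (simp add: algebra_simps)
    then show ?thesis unfolding s_def that(2) by (rule min_absorb1)
  qed
  have sc: "continuous_map ?PY euclideanreal s"
    unfolding s_def by (intro continuous_intros snd df)
  have agree: "cone_class (fst p, 1 - s p * \<beta> (fst p)) = Q (f (cone_class (fst p, min 1 (2 * snd p))))"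
    if p: "p \<in> topspace ?PY" "d (fst p) / 2 = snd p" for p
  proof -
    have x: "fst p \<in> Y" "fst p \<in> topspace X" using p by auto
    have "cone_class (fst p, 1 - s p * \<beta> (fst p)) = k (fst p)"
      using s1[of p] p by (simp add: k_def)
    also have "\<dots> = Q (f (cone_class (fst p, min 1 (2 * snd p))))"
    proof (cases "d (fst p) = 1")
      case True
      then show ?thesis using Qf_top[OF x(2)] p(2)[symmetric] by simp
    next
      case False
      then show ?thesis using k_tip_d[OF x(1)] Qf_tip[OF x(1)] p by auto
    qed
    finally show ?thesis .
  qed
  have h: "continuous_map ?PY ?CY h"
    unfolding h_def
  proof (rule continuous_map_cases_le)
    show "continuous_map ?PY euclideanreal (\<lambda>p. d (fst p) / 2)"
      using continuous_map_real_mult[OF df, of "\<lambda>_. 1/2"] by simp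
    have "s p * \<beta> (fst p) \<in> {0..1}" if "p \<in> topspace ?PY" for p
      using s01[OF that] \<beta>01[of "fst p"] that by (auto intro: mult_le_one)
    then have "continuous_map ?PY unit_interval (\<lambda>p. 1 - s p * \<beta> (fst p))"
      using sc \<beta>f by (auto simp: continuous_map_in_subtopology intro!: continuous_intros)
    then have "continuous_map ?PY ?CY (\<lambda>p. cone_class (fst p, 1 - s p * \<beta> (fst p)))"
      by (intro continuous_map_cone_class fst)
    then show "continuous_map (subtopology ?PY {p \<in> topspace ?PY. d (fst p) / 2 \<le> snd p}) ?CY
        (\<lambda>p. cone_class (fst p, 1 - s p * \<beta> (fst p)))"
      by (rule continuous_map_from_subtopology)
    have "continuous_map ?PY unit_interval (\<lambda>p. min 1 (2 * snd p))"
      using snd by (auto simp: continuous_map_in_subtopology intro!: continuous_intros)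
    then have "continuous_map ?PY ?CX (\<lambda>p. f (cone_class (fst p, min 1 (2 * snd p))))"
      using continuous_map_compose[OF continuous_map_cone_class[OF fst(2)] f]
      by (simp add: o_def)
    then have "continuous_map ?PY (subtopology ?CX F) (\<lambda>p. f (cone_class (fst p, min 1 (2 * snd p))))"
      using YX by (auto simp: continuous_map_in_subtopology intro!: fF)
    then have "continuous_map ?PY ?CY (\<lambda>p. Q (f (cone_class (fst p, min 1 (2 * snd p)))))"
      using continuous_map_compose[OF _ Q] by (simp add: o_def)
    then show "continuous_map (subtopology ?PY {p \<in> topspace ?PY. snd p \<le> d (fst p) / 2}) ?CY
        (\<lambda>p. Q (f (cone_class (fst p, min 1 (2 * snd p)))))"
      by (rule continuous_map_from_subtopology)
  qed (use snd agree in auto)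
  have h0: "h (x, 0) = Q (f tip)" if "x \<in> Y" for x
  proof (cases "d x = 0")
    case True
    then show ?thesis using agree[of "(x, 0)"] that YX tip by (auto simp: h_def)
  next
    case False
    then have "d x > 0" using d01[of x] that YX by auto
    then show ?thesis using tip by (simp add: h_def)
  qed
  have "h p = h q" if "p \<in> topspace ?PY" "q \<in> topspace ?PY" "cone_class p = cone_class q" for p q
    using that h0[of "fst p"] h0[of "fst q"] by (cases p; cases q) (auto simp: cone_class_eq_iff)
  then obtain g where g: "continuous_map ?CY ?CY g"
      and geq: "\<And>p. p \<in> topspace ?PY \<Longrightarrow> g (cone_class p) = h p"
    using quotient_map_lift_exists[OF quotient_map_cone_space h] by metis
  have "g b = b" if b: "b \<in> cone_base ?SY B" for b
  proof -
    consider x where "x \<in> Y" "b = cone_class (x, 1)"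
      | x t where "x \<in> B" "t \<in> {0..1}" "b = cone_class (x, t)"
      using b B(2) by (auto simp: cone_base_def topspace_cone_space)
    then show ?thesis
    proof cases
      case 1
      then show ?thesis using geq[of "(x, 1)"] d01[of x] YX by (auto simp: h_def s_def)
    next
      case 2
      have "x \<in> Y" "x \<in> topspace X" "x \<notin> W'" "d x = 0"
        using 2 B(2) YX d(2) WB W' by auto
      then show ?thesis using geq[of "(x, t)"] 2 \<beta>1[of x] by (auto simp: h_def s_def min_def)
    qed
  qed
  moreover have "cone_class (x0, 1/2) \<notin> g ` topspace ?CY"
  proof
    have k_ne: "k x \<noteq> cone_class (x0, 1/2)" for x
      using \<beta>0 by (auto simp: k_def cone_class_eq_iff)
    assume "cone_class (x0, 1/2) \<in> g ` topspace ?CY"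
    then obtain p where p: "p \<in> topspace ?PY" "h p = cone_class (x0, 1/2)"
      using geq unfolding topspace_cone_space by (force simp: Int_absorb1 YX)
    show False
    proof (cases "d (fst p) / 2 \<le> snd p")
      case True
      then show False using p \<beta>0 by (auto simp: h_def cone_class_eq_iff)
    next
      case False
      define z where "z = f (cone_class (fst p, min 1 (2 * snd p)))"
      have zF: "z \<in> F" using p YX by (auto simp: z_def intro!: fF)
      then obtain y t where "y \<in> topspace X" "t \<in> {0..1}" "z = cone_class (y, t)"
        using closedin_subset[OF F] by (auto simp: topspace_cone_space)
      then have "Q z = (if m \<le> t then k y else tip)" using zF Qeq by simp
      moreover have "tip \<noteq> cone_class (x0, 1/2)" by (simp add: tip_def cone_class_eq_iff)
      ultimately have "Q z \<noteq> cone_class (x0, 1/2)" using k_ne by auto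
      then show False using False p by (simp add: h_def z_def)
    qed
  qed
  moreover have "cone_class (x0, 1/2) \<in> topspace ?CY"
    using x0X by (intro cone_class_in_cone_space) auto
  ultimately show ?thesis
    unfolding surjection_property_def using g by blast
qed

section \<open>Countable unions\<close>

theorem theorem2p1:
  fixes X :: "'a topology" and A :: "'a set"
    and Xs :: "nat \<Rightarrow> 'a set" and As :: "nat \<Rightarrow> 'a set"
  assumes "compact_pair X A"
    and "\<And>i. compact_pair (subtopology X (Xs i)) (As i)"
    and "topspace X = (\<Union>i. Xs i)"
    and "A = (\<Union>i. As i)"
    and "almost_Euclidean_pair X A"
    and "\<And>i. surjection_property (cone_space (subtopology X (Xs i))) (cone_base (subtopology X (Xs i)) (As i))"
  shows "surjection_property (cone_space X) (cone_base X A)"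
proof (rule ccontr)
  assume "\<not> surjection_property (cone_space X) (cone_base X A)"
  then obtain f where f: "continuous_map (cone_space X) (cone_space X) f"
    and f_base: "\<And>b. b \<in> cone_base X A \<Longrightarrow> f b = b"
    and miss: "f ` topspace (cone_space X) \<noteq> topspace (cone_space X)"
    unfolding surjection_property_def by auto
  have X: "compact_space X" "Hausdorff_space X"
    using assms(1) by (auto simp: compact_pair_def metrizable_imp_Hausdorff_space)
  have XsX: "Xs i \<subseteq> topspace X" for i using assms(3) by blast
  have Xs: "closedin X (Xs i)" for i
    using assms(2)[of i] XsX X
    by (simp add: compact_pair_def compactin_subspace compactin_imp_closedin)
  have As: "closedin X (As i)" "As i \<subseteq> Xs i" for i
    using assms(2)[of i] X
    by (auto simp: compact_pair_def compactin_subtopology compactin_imp_closedin)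
  obtain W m where W: "openin X W" "W \<noteq> {}" and m: "0 < m" "m \<le> 1"
    and missed: "\<And>x. x \<in> W \<Longrightarrow> cone_class (x, m) \<notin> f ` topspace (cone_space X)"
    using missed_slab[OF X f miss] by blast
  have "W \<subseteq> (\<Union>i. Xs i)" using openin_subset[OF W(1)] assms(3) by simp
  then obtain i V where V: "openin X V" "V \<noteq> {}" "V \<subseteq> W" "V \<subseteq> Xs i"
    using Baire_closed_cover[where Xs = Xs, OF X Xs W] by metis
  have "f (cone_class (x, 1)) = cone_class (x, 1)" if "x \<in> topspace X" for x
    using that by (intro f_base) (auto simp: cone_base_def)
  moreover have "f (cone_class (x, t)) = cone_class (x, t)" if "x \<in> As i" "t \<in> {0..1}" for x t
    using that assms(4) As(2) XsX by (intro f_base) (force simp: cone_base_def topspace_cone_space)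
  ultimately have "\<not> surjection_property (cone_space (subtopology X (Xs i)))
      (cone_base (subtopology X (Xs i)) (As i))"
    using not_surjection_property_if_slab_missed[OF X Xs As f _ _ V(1,2,4) m] missed V(3) by blast
  then show False using assms(6) by blast
qed

end
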